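(* Let $s\ge1$ be an integer, $\theta=\arctan\sqrt y$ (so $y=\tan^2\theta$) and $\tau_s:=\lfloor s/2\rfloor+1$. Then $$\Psi_s^{\mathrm{cyc}}(y)=\frac{s+2}{2}\cdot\frac{\sin((s+1)\theta)\,\cos^2\theta}{\sin\theta\,\cos((s+2)\theta)}.$$ Moreover, $$\Omega_s^{\mathrm{cyc}}(\tan^2\theta)=\frac{\cos^{s+2}\theta\;\mathcal R_s(\tan^2\theta)-\tau_s\cos((s+2)\theta)}{\tan^2\theta\,\cos((s+2)\theta)},$$ where $\mathcal R_s$ is the explicit polynomial given in the context.
   Context: For integers $d\ge2$ and $s\ge1$ let $$\mathcal P_d^{(s)}=\{x=(x_1,\dots,x_d)\in\mathbb R_{\ge0}^d:\ x_i+x_{i+1}\le s+\delta_i,\ 1\le i\le d-1\},$$ where $\delta_i=0$ for $i$ odd and $\delta_i=1$ for $i$ even. Define $$N_d^{\mathrm{cyc}}(s):=\#\bigl(\{x\in\mathcal P_d^{(s)}:\ x_d+x_1\le s+\delta_d\}\cap\mathbb Z^d\bigr),$$ $$\Psi_s^{\mathrm{cyc}}(y):=\sum_{m\ge1}N_{2m}^{\mathrm{cyc}}(s)\,y^{m-1},\qquad \Omega_s^{\mathrm{cyc}}(y):=\sum_{m\ge1}N_{2m+1}^{\mathrm{cyc}}(s)\,y^{m-1}.$$ Let $P_n(y):=\sum_{k=0}^{\lfloor (n-1)/2\rfloor}\binom{n}{2k+1}y^k$, and put $W=1+y$ and $\widehat P_n=P_n(-y)$ (empty sums are $0$). The polynomial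 $\mathcal R_s(y)$ is: if $s=2\ell$, $$\mathcal R_{2\ell}(y)=\frac12\sum_{r=1}^{\ell}(1+W^{2\ell+2-2r})\widehat P_{2r}+\frac12\widehat P_{2\ell+2}-\frac12\sum_{r=1}^{\ell}(1+W^{2\ell+1-2r})(\widehat P_{2r+1}-W^r);$$ if $s=2\ell+1$, $$\mathcal R_{2\ell+1}(y)=\frac12\sum_{r=1}^{\ell+1}(1+W^{2\ell+3-2r})\widehat P_{2r}-\frac12\sum_{r=1}^{\ell}(1+W^{2\ell+2-2r})(\widehat P_{2r+1}-W^r)-\frac12(\widehat P_{2\ell+3}-W^{\ell+1}).$$ The closed forms are identities of power series: the right-hand sides are even in $\theta$ near $0$, hence power series in $y=\tan^2\theta$ (equivalently, the identities hold for all sufficiently small $y>0$). *)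

theory Defs
  imports "HOL-Analysis.Analysis"
begin

definition bump :: "nat \<Rightarrow> real" where
  "bump i = (if odd i then 0 else 1)"

text \<open>A vector \<open>(x\<^sub>1, \<dots>, x\<^sub>d)\<close> is a function on \<open>{1..d}\<close>, extended by
  \<^const>\<open>undefined\<close> so that distinct functions are distinct vectors.\<close>

definition alt_polytope :: "nat \<Rightarrow> nat \<Rightarrow> (nat \<Rightarrow> real) set" where
  "alt_polytope d s =
     {x \<in> {1..d} \<rightarrow>\<^sub>E {0..}. \<forall>i\<in>{1..d - 1}. x i + x (i + 1) \<le> real s + bump i}"

definition N_cyc :: "nat \<Rightarrow> nat \<Rightarrow> nat" where
  "N_cyc d s =
     card ({x \<in> alt_polytope d s. x d + x 1 \<le> real s + bump d} \<inter> ({1..d} \<rightarrow>\<^sub>E \<int>))"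

text \<open>The sums over \<open>m \<ge> 1\<close> of terms in \<open>y^(m - 1)\<close> are indexed here by \<open>n = m - 1\<close>.\<close>

definition Psi_cyc :: "nat \<Rightarrow> real fps" where
  "Psi_cyc s = Abs_fps (\<lambda>n. real (N_cyc (2 * (n + 1)) s))"

definition Omega_cyc :: "nat \<Rightarrow> real fps" where
  "Omega_cyc s = Abs_fps (\<lambda>n. real (N_cyc (2 * (n + 1) + 1) s))"

definition P_poly :: "nat \<Rightarrow> real poly" where
  "P_poly n = (\<Sum>k=0..(n - 1) div 2. monom (of_nat (n choose (2 * k + 1))) k)"

definition P_hat :: "nat \<Rightarrow> real poly" where
  "P_hat n = pcompose (P_poly n) [:0, -1:]"

definition W :: "real poly" where
  "W = [:1, 1:]"

definition R_even :: "nat \<Rightarrow> real poly" where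
  "R_even l =
     smult (1/2) (\<Sum>r=1..l. (1 + W ^ (2*l + 2 - 2*r)) * P_hat (2*r))
   + smult (1/2) (P_hat (2*l + 2))
   - smult (1/2) (\<Sum>r=1..l. (1 + W ^ (2*l + 1 - 2*r)) * (P_hat (2*r + 1) - W ^ r))"

definition R_odd :: "nat \<Rightarrow> real poly" where
  "R_odd l =
     smult (1/2) (\<Sum>r=1..l + 1. (1 + W ^ (2*l + 3 - 2*r)) * P_hat (2*r))
   - smult (1/2) (\<Sum>r=1..l. (1 + W ^ (2*l + 2 - 2*r)) * (P_hat (2*r + 1) - W ^ r))
   - smult (1/2) (P_hat (2*l + 3) - W ^ (l + 1))"

definition R_poly :: "nat \<Rightarrow> real poly" where
  "R_poly s = (if even s then R_even (s div 2) else R_odd (s div 2))"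

definition tau :: "nat \<Rightarrow> nat" where
  "tau s = s div 2 + 1"

end

theory Submission
  imports Defs
begin

text \<open>
  Cyclic lattice points are closed walks. In a cyclic lattice point every coordinate lies in
  \<open>{0..s}\<close>, because each coordinate takes part in an inequality with right-hand side \<open>s\<close>.
  With the 0-1 matrices \<open>A = [i + j \<le> s]\<close> and \<open>B = [i + j \<le> s + 1]\<close> on this index set,
  the count in dimension \<open>d\<close> is the trace of the product \<open>A B A B \<dots>\<close> of \<open>d\<close> factors
  (\<open>N_cyc_eq_trace\<close>). Hence both generating functions are traces of the two matrix series
  \<open>G = \<Sum>\<^sub>m (A B)\<^sup>m y\<^sup>m = (1 - y A B)\<^sup>-\<^sup>1\<close> and \<open>H = G A\<close>, up to their constant terms:
  \<open>y \<Psi>(y) = tr G - (s + 1)\<close> and \<open>y \<Omega>(y) = tr H - tr A\<close>, where \<open>tr A = \<tau>\<^sub>s\<close>.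

  The point is that \<open>G\<close> and \<open>H\<close> are explicit. With \<open>y = t\<^sup>2\<close> and \<open>t = tan \<theta>\<close>, the
  system \<open>u = e + t A v\<close>, \<open>v = t B u\<close> becomes, after reversing the order of \<open>v\<close> to
  \<open>w\<^sub>i = v\<^bsub>s-i\<^esub>\<close> and taking differences,
  \<open>u\<^sub>i - u\<^bsub>i+1\<^esub> = t w\<^sub>i + (e\<^sub>i - e\<^bsub>i+1\<^esub>)\<close> and \<open>w\<^bsub>i+1\<^esub> - w\<^sub>i = t u\<^bsub>i+2\<^esub>\<close>.
  Away from the source \<open>e\<close>, one step multiplies the complex number \<open>u\<^bsub>i+1\<^esub> + \<i> w\<^sub>i\<close> by
  \<open>cos \<theta> exp (\<i> \<theta>)\<close>. So the solutions are \<open>(cos \<theta>)\<^sup>i\<close> times sines and cosines of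
  multiples of \<open>\<theta>\<close>, a source adds a second solution of the same kind that starts at the
  source, and the boundary condition \<open>u\<^bsub>s+1\<^esub> = 0\<close> produces the denominator
  \<open>cos ((s + 2) \<theta>)\<close>. Once guessed, a column is verified by checking the recurrence
  (\<open>resolvent_column\<close>), and this gives the diagonals in \<open>gen_even_diag\<close> and \<open>gen_odd_diag\<close>.

  It remains to sum the diagonals. For \<open>G\<close> the sum collapses to the closed form of
  \<open>trace_even\<close>. For \<open>H\<close> it is a sum of powers of \<open>cos \<theta>\<close>, partly weighted by cosines of even
  multiples of \<open>\<theta>\<close>. The polynomials \<open>P_hat n\<close> at \<open>tan\<^sup>2 \<theta>\<close> are sines of multiples of \<open>\<theta>\<close>
  in disguise, and their two recurrences turn the definition of \<open>R_poly\<close> into the same sum of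
  cosines (\<open>poly_R_poly\<close>, \<open>trace_odd\<close>).
\<close>

section \<open>Cyclic lattice points as closed walks\<close>

definition edge :: "nat \<Rightarrow> nat \<Rightarrow> nat \<Rightarrow> nat \<Rightarrow> nat" where
  "edge s i a b = of_bool (a + b \<le> s + of_bool (even i))"

fun walks :: "nat \<Rightarrow> nat \<Rightarrow> nat \<Rightarrow> nat \<Rightarrow> nat" where
  "walks s 0 a b = of_bool (a = b)"
| "walks s (Suc d) a b = (\<Sum>c\<le>s. walks s d a c * edge s (Suc d) c b)"

text \<open>
  A path of \<open>d\<close> steps visits the \<open>d + 1\<close> positions \<open>1, \<dots>, d + 1\<close>. The entries are kept as
  real numbers, so that these are literally vectors of the polytope.
\<close>

definition path_set :: "nat \<Rightarrow> nat \<Rightarrow> nat \<Rightarrow> nat \<Rightarrow> (nat \<Rightarrow> real) set" where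
  "path_set s d a b =
     {x \<in> {1..Suc d} \<rightarrow>\<^sub>E real ` {..s}.
        (\<forall>i\<in>{1..d}. x i + x (i + 1) \<le> real s + bump i) \<and> x 1 = real a \<and> x (Suc d) = real b}"

lemma finite_path_set: "finite (path_set s d a b)"
  unfolding path_set_def
  by (rule finite_subset[OF _ finite_PiE[of "{1..Suc d}" "\<lambda>_. real ` {..s}"]]) auto

lemma edge_real: "edge s i a b = of_bool (real a + real b \<le> real s + bump i)"
  unfolding edge_def bump_def by (auto simp flip: of_nat_add of_nat_Suc)

lemma path_set_0: "a \<le> s \<Longrightarrow> path_set s 0 a b = (if a = b then {(\<lambda>i. if i = 1 then real a else undefined)} else {})"
  unfolding path_set_def by (auto simp: PiE_def extensional_def fun_eq_iff)

text \<open>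
  The last step of a path can be split off: the next-to-last entry \<open>c\<close> determines whether \<open>b\<close>
  may be appended. The pieces for different \<open>c\<close> are disjoint, which is what makes the count of
  paths satisfy the recursion of a matrix product.
\<close>

lemma path_set_Suc:
  assumes "b \<le> s"
  shows "path_set s (Suc d) a b =
    (\<Union>c\<in>{c. c \<le> s \<and> edge s (Suc d) c b = 1}. (\<lambda>x. x(Suc (Suc d) := real b)) ` path_set s d a c)"
    (is "?L = ?R")
proof (intro equalityI subsetI)
  fix x assume x: "x \<in> ?L"
  then have "x (Suc d) \<in> real ` {..s}" by (auto simp: path_set_def PiE_def)
  then obtain c where c: "c \<le> s" "x (Suc d) = real c" by auto
  have b: "x (Suc (Suc d)) = real b" using x by (auto simp: path_set_def)
  have "x (Suc d) + x (Suc d + 1) \<le> real s + bump (Suc d)"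
    using x unfolding path_set_def by fastforce
  then have e: "edge s (Suc d) c b = 1" using c b by (simp add: edge_real)
  define x' where "x' = x(Suc (Suc d) := undefined)"
  have "x' \<in> path_set s d a c"
    using x c by (auto simp: path_set_def x'_def PiE_def extensional_def Pi_def)
  moreover have "x = x'(Suc (Suc d) := real b)" using b by (auto simp: x'_def fun_eq_iff)
  ultimately show "x \<in> ?R" using c e by blast
next
  fix x assume "x \<in> ?R"
  then obtain c z where c: "c \<le> s" "edge s (Suc d) c b = 1" and z: "z \<in> path_set s d a c"
    and x: "x = z(Suc (Suc d) := real b)" by auto
  have e: "real c + real b \<le> real s + bump (Suc d)"
    using c by (simp add: edge_real of_bool_def split: if_splits)
  have "x i + x (i + 1) \<le> real s + bump i" if "i \<in> {1..Suc d}" for i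
  proof (cases "i = Suc d")
    case True
    then show ?thesis using z e x by (auto simp: path_set_def)
  next
    case False
    then show ?thesis using z that x by (auto simp: path_set_def)
  qed
  then show "x \<in> ?L"
    using z x assms by (auto simp: path_set_def PiE_def extensional_def Pi_def)
qed

lemma card_path_set: "a \<le> s \<Longrightarrow> b \<le> s \<Longrightarrow> card (path_set s d a b) = walks s d a b"
proof (induction d arbitrary: b)
  case 0
  then show ?case by (simp add: path_set_0)
next
  case (Suc d)
  let ?f = "\<lambda>x::nat\<Rightarrow>real. x(Suc (Suc d) := real b)"
  let ?C = "{c. c \<le> s \<and> edge s (Suc d) c b = 1}"
  have undef: "z (Suc (Suc d)) = undefined" if "z \<in> path_set s d a c" for z c
    using that by (auto simp: path_set_def PiE_def extensional_def)
  have inj: "inj_on ?f (path_set s d a c)" for c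
    by (rule inj_onI) (metis fun_upd_triv fun_upd_upd undef)
  have "card (path_set s (Suc d) a b) = (\<Sum>c\<in>?C. card (?f ` path_set s d a c))"
    unfolding path_set_Suc[OF Suc.prems(2)]
  proof (rule card_UN_disjoint)
    have last: "x (Suc d) = real c" if "x \<in> ?f ` path_set s d a c" for x c
      using that by (auto simp: path_set_def)
    have "?f ` path_set s d a i \<inter> ?f ` path_set s d a j = {}" if "i \<noteq> j" for i j
    proof (rule equals0I)
      fix x assume "x \<in> ?f ` path_set s d a i \<inter> ?f ` path_set s d a j"
      then have "real i = real j" using last[of x i] last[of x j] by simp
      then show False using that by simp
    qed
    then show "\<forall>i\<in>?C. \<forall>j\<in>?C. i \<noteq> j \<longrightarrow> ?f ` path_set s d a i \<inter> ?f ` path_set s d a j = {}"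
      by blast
  qed (auto simp: finite_path_set)
  also have "\<dots> = (\<Sum>c\<in>?C. walks s d a c)"
    by (intro sum.cong refl) (use Suc in \<open>auto simp: card_image[OF inj]\<close>)
  also have "\<dots> = (\<Sum>c\<le>s. if edge s (Suc d) c b = 1 then walks s d a c else 0)"
    by (subst sum.inter_filter[symmetric]) auto
  also have "\<dots> = walks s (Suc d) a b"
    unfolding walks.simps by (intro sum.cong) (auto simp: edge_def)
  finally show ?case .
qed

text \<open>
  Every coordinate \<open>i\<close> occurs in an inequality of odd index, whose right-hand side is \<open>s\<close>: in
  the one with index \<open>i\<close> if \<open>i\<close> is odd (the wrap-around one if \<open>i = d\<close>), and in the one with
  index \<open>i - 1\<close> if \<open>i\<close> is even. So the index set \<open>{0..s}\<close> suffices for both parities.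
\<close>

lemma cyclic_points_bounded:
  assumes d: "d \<ge> 2" and x: "x \<in> alt_polytope d s" "x d + x 1 \<le> real s + bump d"
    and i: "i \<in> {1..d}"
  shows "x i \<le> real s"
proof -
  have nn: "x k \<ge> 0" if "k \<in> {1..d}" for k
    using x(1) that by (auto simp: alt_polytope_def PiE_def Pi_def)
  have le: "x k + x (k + 1) \<le> real s + bump k" if "k \<in> {1..d - 1}" for k
    using x(1) that unfolding alt_polytope_def by blast
  show ?thesis
  proof (cases "odd i")
    case True
    show ?thesis
    proof (cases "i = d")
      case True
      then show ?thesis using x(2) nn[of 1] \<open>odd i\<close> d by (simp add: bump_def)
    next
      case False
      then have "i \<in> {1..d - 1}" "i + 1 \<in> {1..d}" using i by auto
      then show ?thesis using le[of i] nn[of "i + 1"] \<open>odd i\<close> by (simp add: bump_def)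
    qed
  next
    case False
    then have "i \<ge> 2" "odd (i - 1)" using i by (auto elim!: evenE)
    then have "i - 1 \<in> {1..d - 1}" "i - 1 \<in> {1..d}" "i - 1 + 1 = i" using i by auto
    then show ?thesis using le[of "i - 1"] nn[of "i - 1"] \<open>odd (i - 1)\<close> by (simp add: bump_def)
  qed
qed

text \<open>
  A cyclic lattice point is a path with \<open>d - 1\<close> steps from \<open>a\<close> to \<open>b\<close> together with an
  admissible step number \<open>d\<close> from \<open>b\<close> back to \<open>a\<close>, that is, a closed walk of \<open>d\<close> steps.
\<close>

lemma N_cyc_eq_trace:
  assumes d: "d \<ge> 2"
  shows "N_cyc d s = (\<Sum>a\<le>s. walks s d a a)"
proof -
  obtain n where n: "d = Suc n" "n \<ge> 1" using d by (cases d) auto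
  let ?C = "SIGMA a:{..s}. {b. b \<le> s \<and> edge s d b a = 1}"
  have "{x \<in> alt_polytope d s. x d + x 1 \<le> real s + bump d} \<inter> ({1..d} \<rightarrow>\<^sub>E \<int>)
      = (\<Union>(a, b)\<in>?C. path_set s n a b)" (is "?L = ?R")
  proof (intro equalityI subsetI)
    fix x assume x: "x \<in> ?L"
    have mem: "x i \<in> real ` {..s}" if i: "i \<in> {1..d}" for i
    proof -
      have "x i \<in> \<int>" "x i \<ge> 0" using x i by (auto simp: alt_polytope_def PiE_def Pi_def)
      then obtain k where k: "x i = real k"
        by (metis Ints_cases of_int_0_le_iff of_int_of_nat_eq zero_le_imp_eq_int)
      moreover have "x i \<le> real s" using cyclic_points_bounded[OF d] x i by blast
      ultimately show ?thesis by auto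
    qed
    obtain a b where ab: "x 1 = real a" "a \<le> s" "x d = real b" "b \<le> s"
      using mem[of 1] mem[of d] d by auto
    have "edge s d b a = 1" using x ab by (auto simp: edge_real)
    moreover have "x \<in> path_set s n a b"
      using x ab mem n by (auto simp: path_set_def alt_polytope_def PiE_def Pi_def)
    ultimately show "x \<in> ?R" using ab by blast
  next
    fix x assume "x \<in> ?R"
    then obtain a b where ab: "a \<le> s" "b \<le> s" "edge s d b a = 1" and x: "x \<in> path_set s n a b"
      by auto
    have "real b + real a \<le> real s + bump d"
      using ab(3) by (simp add: edge_real of_bool_def split: if_splits)
    moreover have "x i \<in> real ` {..s}" if "i \<in> {1..d}" for i
      using x that n by (auto simp: path_set_def PiE_def Pi_def)
    then have "x i \<in> \<int> \<and> x i \<ge> 0" if "i \<in> {1..d}" for i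
      using that by fastforce
    ultimately show "x \<in> ?L"
      using x n by (auto simp: path_set_def alt_polytope_def PiE_def Pi_def)
  qed
  then have "N_cyc d s = card (\<Union>(a, b)\<in>?C. path_set s n a b)"
    by (simp add: N_cyc_def)
  also have "\<dots> = (\<Sum>(a, b)\<in>?C. card (path_set s n a b))"
  proof -
    have "(\<Sum>p\<in>?C. card (path_set s n (fst p) (snd p))) = card (\<Union>p\<in>?C. path_set s n (fst p) (snd p))"
    proof (rule card_UN_disjoint[symmetric])
      show "\<forall>p\<in>?C. \<forall>q\<in>?C. p \<noteq> q \<longrightarrow>
          path_set s n (fst p) (snd p) \<inter> path_set s n (fst q) (snd q) = {}"
        by (auto simp: path_set_def)
    qed (auto simp: finite_path_set)
    then show ?thesis by (simp add: case_prod_unfold)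
  qed
  also have "\<dots> = (\<Sum>a\<le>s. \<Sum>b\<in>{b. b \<le> s \<and> edge s d b a = 1}. card (path_set s n a b))"
    by (subst sum.Sigma) auto
  also have "\<dots> = (\<Sum>a\<le>s. walks s d a a)"
  proof (rule sum.cong[OF refl])
    fix a assume a: "a \<in> {..s}"
    have "(\<Sum>b\<in>{b. b \<le> s \<and> edge s d b a = 1}. card (path_set s n a b))
        = (\<Sum>b\<in>{b. b \<le> s \<and> edge s d b a = 1}. walks s n a b)"
      using a by (intro sum.cong) (auto simp: card_path_set)
    also have "\<dots> = (\<Sum>b\<le>s. if edge s d b a = 1 then walks s n a b else 0)"
      by (subst sum.inter_filter[symmetric]) auto
    also have "\<dots> = walks s d a a"
      unfolding n walks.simps by (intro sum.cong) (auto simp: edge_def)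
    finally show "(\<Sum>b\<in>{b. b \<le> s \<and> edge s d b a = 1}. card (path_set s n a b)) = walks s d a a" .
  qed
  finally show ?thesis .
qed

section \<open>The matrix generating functions\<close>

lemma walks_le: "walks s d a b \<le> (s + 1) ^ d"
proof (induction d arbitrary: b)
  case (Suc d)
  have "walks s (Suc d) a b \<le> (\<Sum>c\<le>s. (s + 1) ^ d)"
    unfolding walks.simps
    by (rule sum_mono) (use Suc in \<open>auto simp: edge_def\<close>)
  then show ?case by simp
qed simp

text \<open>
  There are at most \<open>(s + 1)\<^sup>d\<close> walks of \<open>d\<close> steps, so all generating functions along walks
  whose length grows by 2 are dominated by a geometric series.
\<close>

lemma summable_walks:
  fixes y :: real
  assumes "0 \<le> y" "y * (real s + 1)\<^sup>2 < 1"
  shows "summable (\<lambda>m. real (walks s (2 * m + r) a b) * y ^ m)"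
proof (rule summable_comparison_test)
  show "summable (\<lambda>m. (real s + 1) ^ r * (y * (real s + 1)\<^sup>2) ^ m)"
    using assms by (intro summable_mult summable_geometric) simp
  have "real (walks s (2 * m + r) a b) * y ^ m
      \<le> (real s + 1) ^ (2 * m + r) * y ^ m" for m
    using assms(1) walks_le[of s "2 * m + r" a b]
    by (intro mult_right_mono) (auto simp flip: of_nat_power of_nat_Suc simp: of_nat_le_iff add.commute)
  moreover have "(real s + 1) ^ (2 * m + r) * y ^ m = (real s + 1) ^ r * (y * (real s + 1)\<^sup>2) ^ m" for m
    by (simp add: power_add power_mult power_mult_distrib)
  ultimately show "\<exists>N. \<forall>m\<ge>N. norm (real (walks s (2 * m + r) a b) * y ^ m)
      \<le> (real s + 1) ^ r * (y * (real s + 1)\<^sup>2) ^ m"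
    using assms(1) by auto
qed

text \<open>
  \<open>gen_even\<close> and \<open>gen_odd\<close> are the entries of the matrices \<open>G\<close> and \<open>H\<close>.
\<close>

definition gen_even :: "nat \<Rightarrow> real \<Rightarrow> nat \<Rightarrow> nat \<Rightarrow> real" where
  "gen_even s y a b = (\<Sum>m. real (walks s (2 * m) a b) * y ^ m)"

definition gen_odd :: "nat \<Rightarrow> real \<Rightarrow> nat \<Rightarrow> nat \<Rightarrow> real" where
  "gen_odd s y a b = (\<Sum>m. real (walks s (2 * m + 1) a b) * y ^ m)"

text \<open>
  Splitting off the last step of a walk gives \<open>H = G A\<close> and \<open>G = 1 + y H B\<close>.
\<close>

lemma gen_odd_eq:
  fixes y :: real
  assumes "0 \<le> y" "y * (real s + 1)\<^sup>2 < 1"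
  shows "gen_odd s y a b = (\<Sum>c\<le>s. gen_even s y a c * of_bool (c + b \<le> s))"
proof -
  have "gen_odd s y a b
      = (\<Sum>m. \<Sum>c\<le>s. real (walks s (2 * m) a c) * y ^ m * of_bool (c + b \<le> s))"
    unfolding gen_odd_def by (simp add: sum_distrib_left sum_distrib_right edge_def mult_ac del: sum_of_bool_mult_eq sum_mult_of_bool_eq)
  also have "\<dots> = (\<Sum>c\<le>s. \<Sum>m. real (walks s (2 * m) a c) * y ^ m * of_bool (c + b \<le> s))"
    using summable_walks[OF assms, of 0] by (intro suminf_sum summable_mult2) simp
  also have "\<dots> = (\<Sum>c\<le>s. gen_even s y a c * of_bool (c + b \<le> s))"
    unfolding gen_even_def
    using summable_walks[OF assms, of 0] by (intro sum.cong refl suminf_mult2[symmetric]) simp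
  finally show ?thesis .
qed

lemma gen_even_eq:
  fixes y :: real
  assumes "0 \<le> y" "y * (real s + 1)\<^sup>2 < 1"
  shows "gen_even s y a b
    = of_bool (a = b) + y * (\<Sum>c\<le>s. gen_odd s y a c * of_bool (c + b \<le> s + 1))"
proof -
  have "gen_even s y a b
      = of_bool (a = b) + (\<Sum>m. real (walks s (2 * Suc m) a b) * y ^ Suc m)"
    unfolding gen_even_def
    using suminf_split_head[OF summable_walks[OF assms, of 0 a b]] by simp
  also have "(\<Sum>m. real (walks s (2 * Suc m) a b) * y ^ Suc m)
      = (\<Sum>m. \<Sum>c\<le>s. y * (real (walks s (2 * m + 1) a c) * y ^ m * of_bool (c + b \<le> s + 1)))"
  proof (intro suminf_cong)
    fix m
    have "walks s (2 * Suc m) a b = (\<Sum>c\<le>s. walks s (2 * m + 1) a c * of_bool (c + b \<le> s + 1))"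
      by (simp add: edge_def del: sum_of_bool_mult_eq sum_mult_of_bool_eq)
    then show "real (walks s (2 * Suc m) a b) * y ^ Suc m
      = (\<Sum>c\<le>s. y * (real (walks s (2 * m + 1) a c) * y ^ m * of_bool (c + b \<le> s + 1)))"
      by (simp add: sum_distrib_left sum_distrib_right mult_ac del: sum_of_bool_mult_eq sum_mult_of_bool_eq walks.simps)
  qed
  also have "\<dots> = (\<Sum>c\<le>s. \<Sum>m. y * (real (walks s (2 * m + 1) a c) * y ^ m * of_bool (c + b \<le> s + 1)))"
    using summable_walks[OF assms, of 1] by (intro suminf_sum summable_mult summable_mult2) 
  also have "\<dots> = (\<Sum>c\<le>s. y * (gen_odd s y a c * of_bool (c + b \<le> s + 1)))"
    unfolding gen_odd_def
    using summable_walks[OF assms, of 1]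
    by (simp add: suminf_mult suminf_mult2[symmetric] summable_mult2 del: sum_of_bool_mult_eq sum_mult_of_bool_eq walks.simps)
  finally show ?thesis by (simp add: sum_distrib_left del: sum_of_bool_mult_eq sum_mult_of_bool_eq)
qed

text \<open>
  Together the two relations say \<open>G (1 - t\<^sup>2 A B) = 1\<close>, so a vector \<open>u\<close> with
  \<open>(1 - t\<^sup>2 A B) u = e\<close> must be \<open>G e\<close>: it suffices to exhibit a solution, and no invertibility
  has to be established. The equation for \<open>u\<close> is given here in differenced form, with the
  auxiliary vector \<open>w\<^sub>i = t (B u)\<^bsub>s-i\<^esub>\<close>. The extra entry \<open>u (s + 1) = 0\<close> removes the
  truncation at the end of the index range, both in \<open>A\<close> and in row \<open>0\<close> of \<open>B\<close>, which would
  involve the index \<open>s + 1\<close>.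
\<close>

lemma resolvent_column:
  fixes t :: real and u w e :: "nat \<Rightarrow> real"
  assumes small: "t\<^sup>2 * (real s + 1)\<^sup>2 < 1"
    and a: "a \<le> s"
    and u_end: "u (s + 1) = 0" and e_end: "e (s + 1) = 0"
    and u_step: "\<And>i. i \<le> s \<Longrightarrow> u i - u (i + 1) = t * w i + (e i - e (i + 1))"
    and w_0: "w 0 = t * (u 0 + u 1)"
    and w_step: "\<And>i. i < s \<Longrightarrow> w (i + 1) = w i + t * u (i + 2)"
  shows "(\<Sum>b\<le>s. gen_even s (t\<^sup>2) a b * e b) = u a"
proof -
  let ?G = "gen_even s (t\<^sup>2) a" and ?H = "gen_odd s (t\<^sup>2) a"
  have w_sum: "w i = t * (\<Sum>j\<le>i + 1. u j)" if "i \<le> s" for i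
    using that
  proof (induction i)
    case 0
    then show ?case using w_0 by simp
  next
    case (Suc i)
    then show ?case using w_step[of i] by (simp add: algebra_simps)
  qed
  have u_sum: "u i - e i = t * (\<Sum>l\<in>{i..s}. w l)" if "i \<le> s + 1" for i
    using that
  proof (induction rule: inc_induct)
    case base
    then show ?case using u_end e_end by simp
  next
    case (step i)
    have "{i..s} = insert i {Suc i..s}" using step by auto
    then show ?case using step u_step[of i] by (simp add: algebra_simps)
  qed
  have w_B: "w (s - l) = t * (\<Sum>j\<le>s. of_bool (l + j \<le> s + 1) * u j)" if l: "l \<le> s" for l
  proof -
    have "(\<Sum>j\<le>s. of_bool (l + j \<le> s + 1) * u j) = (\<Sum>j\<le>s + 1. of_bool (l + j \<le> s + 1) * u j)"
      using u_end by simp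
    also have "\<dots> = (\<Sum>j\<le>s - l + 1. u j)"
      using l by (intro sum.mono_neutral_cong_right) auto
    finally show ?thesis using w_sum[of "s - l"] by simp
  qed
  have u_A: "u b - e b = t * (\<Sum>l\<le>s. of_bool (b + l \<le> s) * w (s - l))" if b: "b \<le> s" for b
  proof -
    have "(\<Sum>l\<le>s. of_bool (b + l \<le> s) * w (s - l)) = (\<Sum>l\<le>s - b. w (s - l))"
      using b by (intro sum.mono_neutral_cong_right) auto
    also have "\<dots> = (\<Sum>l\<in>{b..s}. w l)"
      by (rule sum.reindex_bij_witness[where i="\<lambda>l. s - l" and j="\<lambda>l. s - l"]) (use b in auto)
    finally have "(\<Sum>l\<le>s. of_bool (b + l \<le> s) * w (s - l)) = (\<Sum>l\<in>{b..s}. w l)" .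
    then show ?thesis using u_sum[of b] b by simp
  qed
  have y: "0 \<le> t\<^sup>2" by simp
  have "(\<Sum>b\<le>s. ?G b * (u b - e b))
      = t * (\<Sum>b\<le>s. \<Sum>l\<le>s. ?G b * of_bool (b + l \<le> s) * w (s - l))"
    by (simp add: u_A sum_distrib_left mult_ac del: sum_of_bool_mult_eq sum_mult_of_bool_eq)
  also have "\<dots> = t * (\<Sum>l\<le>s. ?H l * w (s - l))"
    unfolding gen_odd_eq[OF y small] by (subst sum.swap) (simp add: sum_distrib_right del: sum_of_bool_mult_eq sum_mult_of_bool_eq)
  also have "\<dots> = t * (\<Sum>l\<le>s. \<Sum>j\<le>s. t * (?H l * of_bool (l + j \<le> s + 1) * u j))"
    by (intro arg_cong[where f="\<lambda>x. t * x"] sum.cong refl)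
       (simp add: w_B sum_distrib_left mult_ac del: sum_of_bool_mult_eq sum_mult_of_bool_eq)
  also have "\<dots> = (\<Sum>j\<le>s. (t\<^sup>2 * (\<Sum>l\<le>s. ?H l * of_bool (l + j \<le> s + 1))) * u j)"
    by (subst sum.swap) (simp add: sum_distrib_right sum_distrib_left power2_eq_square mult_ac del: sum_of_bool_mult_eq sum_mult_of_bool_eq)
  also have "\<dots> = (\<Sum>j\<le>s. (?G j - of_bool (a = j)) * u j)"
    using gen_even_eq[OF y small, of a] by simp
  also have "\<dots> = (\<Sum>j\<le>s. ?G j * u j) - (\<Sum>j\<le>s. of_bool (a = j) * u j)"
    by (simp only: left_diff_distrib sum_subtractf)
  also have "(\<Sum>j\<le>s. of_bool (a = j) * u j) = (\<Sum>j\<le>s. if a = j then u j else 0)"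
    by (intro sum.cong) auto
  also have "\<dots> = u a"
    using a by simp
  finally show ?thesis by (simp add: right_diff_distrib sum_subtractf)
qed

section \<open>Explicit columns of the resolvent\<close>

text \<open>
  One step of the recurrence is a rotation by \<open>\<theta>\<close> scaled by \<open>cos \<theta>\<close>. Solving for the
  values before the step avoids divisions. Apart from the Pythagorean identity at the source,
  the verification of the columns needs no other trigonometry.
\<close>

lemma cos_step_back: "cos (z * \<theta>) = cos \<theta> * cos ((z + 1) * \<theta>) + sin \<theta> * sin ((z + 1) * \<theta>)"
  for z \<theta> :: real
  using cos_diff[of "(z + 1) * \<theta>" \<theta>] by (simp add: algebra_simps)

lemma sin_step_back: "sin (z * \<theta>) = cos \<theta> * sin ((z + 1) * \<theta>) - sin \<theta> * cos ((z + 1) * \<theta>)"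
  for z \<theta> :: real
  using sin_diff[of "(z + 1) * \<theta>" \<theta>] by (simp add: algebra_simps)

text \<open>
  The column of \<open>G\<close> for the unit vector at \<open>j\<close>. In terms of \<open>u\<^bsub>i+1\<^esub> + \<i> w\<^sub>i\<close> the unit source
  acts as a kick \<open>\<i> sin \<theta> exp (\<i> \<theta>)\<close> at position \<open>j\<close>, apart from the entry \<open>u\<^sub>j\<close>, which
  carries an additional 1. The kick is then rotated along with everything else. The amplitude
  \<open>S\<close> of the homogeneous part is determined by \<open>u\<^bsub>s+1\<^esub> = 0\<close>.
\<close>

lemma gen_even_diag:
  fixes \<theta> :: real
  assumes c0: "cos \<theta> \<noteq> 0" and C0: "cos ((real s + 2) * \<theta>) \<noteq> 0"
    and small: "(tan \<theta>)\<^sup>2 * (real s + 1)\<^sup>2 < 1" and j: "j \<le> s"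
  shows "gen_even s ((tan \<theta>)\<^sup>2) j j
    = 1 + sin \<theta> * (sin ((real s + 2 - real j) * \<theta>) * cos ((real j + 1) * \<theta>) / cos ((real s + 2) * \<theta>) - sin \<theta>)"
proof -
  define c \<sigma> where "c = cos \<theta>" and "\<sigma> = sin \<theta>"
  have t: "tan \<theta> = \<sigma> / c" by (simp add: tan_def c_def \<sigma>_def)
  have c: "c \<noteq> 0" using c0 by (simp add: c_def)
  have sq: "\<sigma> * \<sigma> = 1 - c * c"
    using sin_cos_squared_add[of \<theta>] by (simp add: c_def \<sigma>_def power2_eq_square)
  define K S where "K = \<sigma> / c ^ j" and "S = sin ((real s + 2 - real j) * \<theta>) / cos ((real s + 2) * \<theta>)"
  define co si where "co z = cos (z * \<theta>)" and "si z = sin (z * \<theta>)" for z :: real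
  have co: "co z = c * co (z + 1) + \<sigma> * si (z + 1)"
    and si: "si z = c * si (z + 1) - \<sigma> * co (z + 1)" for z
    unfolding co_def si_def c_def \<sigma>_def by (rule cos_step_back sin_step_back)+
  have co0: "co 0 = 1" "si 0 = 0" "co 1 = c" "si 1 = \<sigma>"
    by (simp_all add: co_def si_def c_def \<sigma>_def)
  \<comment> \<open>The truncation could equally be at \<open>j \<le> i\<close>, since the sine vanishes at \<open>i + 1 = j\<close>. In
    this form it is the same in \<open>u\<close> and \<open>w\<close>, so that only few cases have to be distinguished.\<close>
  define u where "u i = K * c ^ i * (S * co (real i + 1)
      - of_bool (j \<le> i + 1) * si (real i - real j + 1)) + of_bool (i = j)" for i
  define w where "w i = K * c ^ (i + 1) * (S * si (real i + 2)
      + of_bool (j \<le> i + 1) * co (real i - real j + 2))" for i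
  define e :: "nat \<Rightarrow> real" where "e i = of_bool (i = j)" for i
  have "(\<Sum>b\<le>s. gen_even s ((tan \<theta>)\<^sup>2) j b * e b) = u j"
  proof (rule resolvent_column[OF small j])
    have *: "S * co (real s + 2) = si (real s - real j + 2)"
      using C0 by (simp add: S_def co_def si_def algebra_simps)
    show "u (s + 1) = 0"
    proof -
      have 3: "real (s + 1) + 1 = real s + 2" "real (s + 1) - real j + 1 = real s - real j + 2"
        by simp_all
      show ?thesis unfolding u_def 3 using j * by simp
    qed
    show "e (s + 1) = 0" using j by (simp add: e_def)
    show "u i - u (i + 1) = tan \<theta> * w i + (e i - e (i + 1))" for i
    proof (cases "j \<le> i + 1")
      case True
      have 1: "co (real i + 1) = c * co (real i + 2) + \<sigma> * si (real i + 2)"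
        using co[of "real i + 1"] by (simp add: add.assoc)
      have 2: "si (real i - real j + 1) = c * si (real i - real j + 2) - \<sigma> * co (real i - real j + 2)"
        using si[of "real i - real j + 1"] by (simp add: add.assoc)
      have 3: "real (i + 1) + 1 = real i + 2" "real (i + 1) - real j + 1 = real i - real j + 2" by simp_all
      show ?thesis using True c unfolding u_def w_def e_def t 3 1 2
        by (simp add: field_simps)
    next
      case False
      have 1: "co (real i + 1) = c * co (real i + 2) + \<sigma> * si (real i + 2)"
        using co[of "real i + 1"] by (simp add: add.assoc)
      have 3: "real (i + 1) + 1 = real i + 2" by simp
      have 4: "of_bool (j \<le> i + 1 + 1) * si (real (i + 1) - real j + 1) = 0"
        using False by (cases "j = i + 2") (auto simp: co0)
      show ?thesis using False c unfolding u_def w_def e_def t 4 3 1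
        by (simp add: field_simps)
    qed
    have co1: "c = c * co 2 + \<sigma> * si 2" "\<sigma> = c * si 2 - \<sigma> * co 2"
      using co[of 1] si[of 1] by (simp_all add: co0)
    show "w 0 = tan \<theta> * (u 0 + u 1)"
    proof -
      consider "j = 0" | "j = 1" | "j \<ge> 2" by linarith
      then show ?thesis
      proof cases
        case 1
        then have vals: "K = \<sigma>" "u 0 = \<sigma> * (S * c - \<sigma>) + 1" "u 1 = \<sigma> * c * (S * co 2 - si 2)"
          "w 0 = \<sigma> * c * (S * si 2 + co 2)"
          by (simp_all add: u_def w_def K_def co0)
        have "c * w 0 = \<sigma> * (u 0 + u 1)"
          unfolding vals using co1 sq by algebra
        then show ?thesis using c by (simp add: t field_simps)
      next
        case 2
        then have "K = \<sigma> / c" by (simp add: K_def)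
        then have vals: "u 0 = \<sigma> * S" "u 1 = \<sigma> * (S * co 2 - \<sigma>) + 1"
          "w 0 = \<sigma> * (S * si 2 + c)"
          using 2 c by (simp_all add: u_def w_def co0)
        have "c * w 0 = \<sigma> * (u 0 + u 1)"
          unfolding vals using co1 sq by algebra
        then show ?thesis using c by (simp add: t field_simps)
      next
        case 3
        have off: "of_bool (j \<le> 1 + 1) * si (real 1 - real j + 1) = 0"
          using 3 co0 by (cases "j = 2") auto
        have vals: "u 0 = K * (S * c)" "u 1 = K * c * (S * co 2)" "w 0 = K * c * (S * si 2)"
          unfolding u_def w_def off using 3 by (simp_all add: co0)
        have "c * w 0 = \<sigma> * (u 0 + u 1)"
          unfolding vals using co1 by algebra
        then show ?thesis using c by (simp add: t field_simps)
      qed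
    qed
    show "w (i + 1) = w i + tan \<theta> * u (i + 2)" for i
    proof -
      have si_i: "si (real i + 2) = c * si (real i + 3) - \<sigma> * co (real i + 3)"
        using si[of "real i + 2"] by (simp add: add.assoc)
      have co_i: "co (real i - real j + 2) = c * co (real i - real j + 3) + \<sigma> * si (real i - real j + 3)"
        using co[of "real i - real j + 2"] by (simp add: add.assoc)
      have eqs: "real (i + 1) + 2 = real i + 3" "real (i + 1) - real j + 2 = real i - real j + 3"
        "real (i + 2) + 1 = real i + 3" "real (i + 2) - real j + 1 = real i - real j + 3" by simp_all
      consider "j \<le> i + 1" | "j = i + 2" | "j > i + 2" by linarith
      then show ?thesis
      proof cases
        case 1
        then have vals: "u (i + 2) = K * c ^ i * c * c * (S * co (real i + 3) - si (real i - real j + 3))"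
          "w i = K * c ^ i * c * (S * si (real i + 2) + co (real i - real j + 2))"
          "w (i + 1) = K * c ^ i * c * c * (S * si (real i + 3) + co (real i - real j + 3))"
          unfolding u_def w_def eqs by (simp_all add: mult_ac)
        have "c * w (i + 1) = c * w i + \<sigma> * u (i + 2)"
          unfolding vals si_i co_i by (simp add: algebra_simps)
        then show ?thesis using c by (simp add: t field_simps)
      next
        case 2
        \<comment> \<open>The kick: \<open>w i\<close> lies before the source, \<open>w (i + 1)\<close> after it, and
          \<open>u (i + 2)\<close> is the entry at the source.\<close>
        then have j: "real i - real j + 2 = 0" "real i - real j + 3 = 1" "K * c ^ i * c * c = \<sigma>"
          using c by (simp_all add: K_def power_add)
        have vals: "u (i + 2) = \<sigma> * (S * co (real i + 3) - \<sigma>) + 1"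
          "w i = K * c ^ i * c * (S * si (real i + 2))"
          "w (i + 1) = \<sigma> * (S * si (real i + 3) + c)"
          unfolding u_def w_def eqs j(3)[symmetric] j(1,2) co0 using 2 by (simp_all add: mult_ac)
        have "c * w (i + 1) = c * w i + \<sigma> * u (i + 2)"
        proof -
          have absorb: "c * (K * c ^ i * c * x) = \<sigma> * x" for x
            unfolding j(3)[symmetric] by simp
          show ?thesis unfolding vals si_i absorb using sq by algebra
        qed
        then show ?thesis using c by (simp add: t field_simps)
      next
        case 3
        then have "of_bool (j \<le> i + 2 + 1) * si (real i - real j + 3) = 0"
          using co0 by (cases "j = i + 3") auto
        then have vals: "u (i + 2) = K * c ^ i * c * c * (S * co (real i + 3))"
          "w i = K * c ^ i * c * (S * si (real i + 2))"
          "w (i + 1) = K * c ^ i * c * c * (S * si (real i + 3))"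
          unfolding u_def w_def eqs using 3 by (simp_all add: mult_ac)
        have "c * w (i + 1) = c * w i + \<sigma> * u (i + 2)"
          unfolding vals si_i by (simp add: algebra_simps)
        then show ?thesis using c by (simp add: t field_simps)
      qed
    qed
  qed
  moreover have "(\<Sum>b\<le>s. gen_even s ((tan \<theta>)\<^sup>2) j b * e b)
      = (\<Sum>b\<le>s. if b = j then gen_even s ((tan \<theta>)\<^sup>2) j b else 0)"
    by (intro sum.cong) (auto simp: e_def)
  ultimately show ?thesis
    using j c by (simp add: u_def K_def S_def co0) (simp add: co_def \<sigma>_def algebra_simps)
qed

text \<open>
  The column \<open>k\<close> of \<open>H = G A\<close> is \<open>G\<close> applied to column \<open>k\<close> of \<open>A\<close>, so the source is the step
  function \<open>[i + k \<le> s]\<close>. Its only jump is at \<open>i = s - k\<close>, and there it acts as a kick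
  proportional to \<open>- exp (\<i> \<theta>)\<close>. As before \<open>S\<close> is fixed by \<open>u\<^bsub>s+1\<^esub> = 0\<close>. The entry \<open>(i, k)\<close>
  comes out symmetric in \<open>i\<close> and \<open>k\<close>, as it must since \<open>A\<close> and \<open>B\<close> are symmetric.
\<close>

lemma gen_odd_diag:
  fixes \<theta> :: real
  assumes c0: "cos \<theta> \<noteq> 0" and C0: "cos ((real s + 2) * \<theta>) \<noteq> 0"
    and small: "(tan \<theta>)\<^sup>2 * (real s + 1)\<^sup>2 < 1" and k: "k \<le> s"
  shows "gen_odd s ((tan \<theta>)\<^sup>2) k k
    = cos \<theta> ^ (2 * k) / cos \<theta> ^ s * ((cos ((real k + 1) * \<theta>))\<^sup>2 / cos ((real s + 2) * \<theta>)
        - of_bool (s < 2 * k) * cos ((2 * real k - real s) * \<theta>))"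
proof -
  define c \<sigma> where "c = cos \<theta>" and "\<sigma> = sin \<theta>"
  have t: "tan \<theta> = \<sigma> / c" by (simp add: tan_def c_def \<sigma>_def)
  have c: "c \<noteq> 0" using c0 by (simp add: c_def)
  define co si where "co z = cos (z * \<theta>)" and "si z = sin (z * \<theta>)" for z :: real
  have sq: "\<sigma> * \<sigma> = 1 - c * c"
    using sin_cos_squared_add[of \<theta>] by (simp add: c_def \<sigma>_def power2_eq_square)
  define K S where "K = c ^ k / c ^ s" and "S = co (real k + 1) / co (real s + 2)"
  have co: "co z = c * co (z + 1) + \<sigma> * si (z + 1)"
    and si: "si z = c * si (z + 1) - \<sigma> * co (z + 1)" for z
    unfolding co_def si_def c_def \<sigma>_def by (rule cos_step_back sin_step_back)+
  have co0: "co 0 = 1" "si 0 = 0" "co 1 = c" "si 1 = \<sigma>"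
    by (simp_all add: co_def si_def c_def \<sigma>_def)
  define u where "u i = K * c ^ i * (S * co (real i + 1)
      - of_bool (s < i + k) * co (real i + real k - real s))" for i
  define w where "w i = K * c ^ (i + 1) * (S * si (real i + 2)
      - of_bool (s \<le> i + k) * si (real i + real k - real s + 1))" for i
  define e :: "nat \<Rightarrow> real" where "e i = of_bool (i + k \<le> s)" for i
  have "(\<Sum>b\<le>s. gen_even s ((tan \<theta>)\<^sup>2) k b * e b) = u k"
  proof (rule resolvent_column[OF small k])
    have *: "S * co (real s + 2) = co (real k + 1)"
      using C0 by (simp add: S_def co_def)
    show "u (s + 1) = 0"
    proof -
      have 3: "real (s + 1) + 1 = real s + 2" "real (s + 1) + real k - real s = real k + 1"
        by simp_all
      show ?thesis unfolding u_def 3 using * by (cases k) simp_all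
    qed
    show "e (s + 1) = 0" by (simp add: e_def)
    show "u i - u (i + 1) = tan \<theta> * w i + (e i - e (i + 1))" for i
    proof -
      have step1: "co (real i + 1) = c * co (real i + 2) + \<sigma> * si (real i + 2)"
        using co[of "real i + 1"] by (simp add: add.assoc)
      have step2: "co (real i + real k - real s)
          = c * co (real i + real k - real s + 1) + \<sigma> * si (real i + real k - real s + 1)"
        by (rule co)
      have eqs: "real (i + 1) + 1 = real i + 2" "real (i + 1) + real k - real s = real i + real k - real s + 1" by simp_all
      consider "i + k < s" | "i + k = s" | "i + k > s" by linarith
      then show ?thesis
      proof cases
        case 1
        then have vals: "u i = K * c ^ i * (S * co (real i + 1))"
          "u (i + 1) = K * c ^ i * c * (S * co (real i + 2))"
          "w i = K * c ^ i * c * (S * si (real i + 2))" "e i = e (i + 1)"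
          unfolding u_def w_def e_def eqs by (simp_all add: mult_ac)
        have "c * (u i - u (i + 1)) = \<sigma> * w i + c * (e i - e (i + 1))"
          unfolding vals step1 step2 by (simp add: algebra_simps)
        then show ?thesis using c by (simp add: t field_simps)
      next
        case 2
        then have z: "real i + real k - real s = 0" "K * c ^ i = 1"
          using c by (simp_all add: K_def 2[symmetric] power_add)
        have vals: "u i = S * co (real i + 1)" "u (i + 1) = c * (S * co (real i + 2) - c)"
          "w i = c * (S * si (real i + 2) - \<sigma>)" "e i = 1" "e (i + 1) = 0"
          unfolding u_def w_def e_def eqs using 2 z co0
          by (simp_all add: mult_ac)
        have "c * (u i - u (i + 1)) = \<sigma> * w i + c * (e i - e (i + 1))"
          unfolding vals step1 using sq by algebra
        then show ?thesis using c by (simp add: t field_simps)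
      next
        case 3
        then have vals: "u i = K * c ^ i * (S * co (real i + 1) - co (real i + real k - real s))"
          "u (i + 1) = K * c ^ i * c * (S * co (real i + 2) - co (real i + real k - real s + 1))"
          "w i = K * c ^ i * c * (S * si (real i + 2) - si (real i + real k - real s + 1))"
          "e i = e (i + 1)"
          unfolding u_def w_def e_def eqs by (simp_all add: mult_ac)
        have "c * (u i - u (i + 1)) = \<sigma> * w i + c * (e i - e (i + 1))"
          unfolding vals step1 step2 by (simp add: algebra_simps)
        then show ?thesis using c by (simp add: t field_simps)
      qed
    qed
    have co1: "c = c * co 2 + \<sigma> * si 2" "\<sigma> = c * si 2 - \<sigma> * co 2"
      using co[of 1] si[of 1] by (simp_all add: co0)
    show "w 0 = tan \<theta> * (u 0 + u 1)"
    proof (cases "k = s")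
      case True
      then have vals: "u 0 = K * (S * c)" "u 1 = K * c * (S * co 2 - c)" "w 0 = K * c * (S * si 2 - \<sigma>)"
        by (simp_all add: u_def w_def co0)
      have "c * w 0 = \<sigma> * (u 0 + u 1)"
        unfolding vals using co1 by algebra
      then show ?thesis using c by (simp add: t field_simps)
    next
      case False
      then have vals: "u 0 = K * (S * c)" "u 1 = K * c * (S * co 2)" "w 0 = K * c * (S * si 2)"
        using k by (simp_all add: u_def w_def co0)
      have "c * w 0 = \<sigma> * (u 0 + u 1)"
        unfolding vals using co1 by algebra
      then show ?thesis using c by (simp add: t field_simps)
    qed
    show "w (i + 1) = w i + tan \<theta> * u (i + 2)" for i
    proof -
      let ?x = "real i + real k - real s"
      have si_i: "si (real i + 2) = c * si (real i + 3) - \<sigma> * co (real i + 3)"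
        using si[of "real i + 2"] by (simp add: add.assoc)
      have si_x: "si (?x + 1) = c * si (?x + 2) - \<sigma> * co (?x + 2)"
        using si[of "?x + 1"] by (simp add: add.assoc)
      have eqs: "real (i + 1) + 2 = real i + 3" "real (i + 1) + real k - real s + 1 = ?x + 2"
        "real (i + 2) + 1 = real i + 3" "real (i + 2) + real k - real s = ?x + 2" by simp_all
      show ?thesis
      proof (cases "s \<le> i + k + 1")
        case True
        have "of_bool (s \<le> i + k) * si (?x + 1) = si (?x + 1)"
        proof (cases "s \<le> i + k")
          case False
          then have "s = i + k + 1" using True by simp
          then show ?thesis by (simp add: co0)
        qed simp
        then have vals: "u (i + 2) = K * c ^ i * c * c * (S * co (real i + 3) - co (?x + 2))"
          "w i = K * c ^ i * c * (S * si (real i + 2) - si (?x + 1))"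
          "w (i + 1) = K * c ^ i * c * c * (S * si (real i + 3) - si (?x + 2))"
          unfolding u_def w_def eqs using True by (simp_all add: mult_ac)
        have "c * w (i + 1) = c * w i + \<sigma> * u (i + 2)"
          unfolding vals si_i si_x by (simp add: algebra_simps)
        then show ?thesis using c by (simp add: t field_simps)
      next
        case False
        then have vals: "u (i + 2) = K * c ^ i * c * c * (S * co (real i + 3))"
          "w i = K * c ^ i * c * (S * si (real i + 2))"
          "w (i + 1) = K * c ^ i * c * c * (S * si (real i + 3))"
          unfolding u_def w_def eqs by (simp_all add: mult_ac)
        have "c * w (i + 1) = c * w i + \<sigma> * u (i + 2)"
          unfolding vals si_i by (simp add: algebra_simps)
        then show ?thesis using c by (simp add: t field_simps)
      qed
    qed
  qed
  moreover have "(\<Sum>b\<le>s. gen_even s ((tan \<theta>)\<^sup>2) k b * e b) = gen_odd s ((tan \<theta>)\<^sup>2) k k"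
    unfolding gen_odd_eq[OF zero_le_power2 small] by (simp add: e_def)
  moreover have "K * c ^ k = cos \<theta> ^ (2 * k) / cos \<theta> ^ s"
    by (simp add: K_def c_def mult_2 power_add)
  ultimately have "gen_odd s ((tan \<theta>)\<^sup>2) k k = cos \<theta> ^ (2 * k) / cos \<theta> ^ s *
      (S * co (real k + 1) - of_bool (s < k + k) * co (real k + real k - real s))"
    by (simp add: u_def)
  then show ?thesis
    by (simp add: S_def co_def power2_eq_square flip: mult_2)
qed

section \<open>The even trace\<close>

text \<open>
  The product of sine and cosine in each diagonal entry is half a constant plus half the sine of
  \<open>(s + 1 - 2 j) \<theta>\<close>. These angles run through \<open>s + 1, s - 1, \<dots>, - s + 1\<close>, so all the sines but
  the first cancel in pairs.
\<close>

lemma trace_even: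
  fixes \<theta> :: real
  assumes c0: "cos \<theta> \<noteq> 0" and C0: "cos ((real s + 2) * \<theta>) \<noteq> 0"
    and small: "(tan \<theta>)\<^sup>2 * (real s + 1)\<^sup>2 < 1"
  shows "(\<Sum>j\<le>s. gen_even s ((tan \<theta>)\<^sup>2) j j - 1)
    = (real s + 2) / 2 * (sin \<theta> * sin ((real s + 1) * \<theta>) / cos ((real s + 2) * \<theta>))"
proof -
  define C where "C = cos ((real s + 2) * \<theta>)"
  define \<phi> where "\<phi> j = sin ((real s + 1 - 2 * real j) * \<theta>)" for j
  have prod: "2 * (sin ((real s + 2 - real j) * \<theta>) * cos ((real j + 1) * \<theta>))
      = sin ((real s + 3) * \<theta>) + \<phi> j" for j
    unfolding sin_times_cos \<phi>_def by (simp add: algebra_simps)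
  have diag: "gen_even s ((tan \<theta>)\<^sup>2) j j - 1
      = sin \<theta> / 2 * ((sin ((real s + 3) * \<theta>) + \<phi> j) / C - 2 * sin \<theta>)" if "j \<le> s" for j
    unfolding gen_even_diag[OF c0 C0 small that] prod[symmetric] C_def by (simp add: algebra_simps)
  have "(\<Sum>j=1..s. \<phi> j) = (\<Sum>j=1..s. - \<phi> j)"
  proof (rule sum.reindex_bij_witness[where i="\<lambda>j. s + 1 - j" and j="\<lambda>j. s + 1 - j"])
    fix j assume "j \<in> {1..s}"
    then have "(real s + 1 - 2 * real (s + 1 - j)) * \<theta> = - ((real s + 1 - 2 * real j) * \<theta>)"
      by (simp add: of_nat_diff algebra_simps)
    then show "- \<phi> (s + 1 - j) = \<phi> j" unfolding \<phi>_def by (metis minus_minus sin_minus)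
  qed auto
  then have "(\<Sum>j=1..s. \<phi> j) = 0" by (simp add: sum_negf)
  moreover have "{..s} = insert 0 {1..s}" by auto
  ultimately have \<phi>_sum: "(\<Sum>j\<le>s. \<phi> j) = sin ((real s + 1) * \<theta>)"
    by (simp add: \<phi>_def)
  have "(\<Sum>j\<le>s. gen_even s ((tan \<theta>)\<^sup>2) j j - 1)
      = (\<Sum>j\<le>s. sin \<theta> / 2 * ((sin ((real s + 3) * \<theta>) + \<phi> j) / C - 2 * sin \<theta>))"
    by (intro sum.cong) (auto simp: diag)
  also have "\<dots> = sin \<theta> / 2 * (((real s + 1) * sin ((real s + 3) * \<theta>) + (\<Sum>j\<le>s. \<phi> j)) / C
      - (real s + 1) * 2 * sin \<theta>)"
    by (simp add: sum_distrib_left[symmetric] sum_subtractf sum_divide_distrib[symmetric] sum.distrib)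
      (simp add: algebra_simps add_divide_distrib)
  also have "\<dots> = (real s + 2) / 2 * (sin \<theta> * sin ((real s + 1) * \<theta>) / C)"
  proof -
    have up: "sin ((real s + 3) * \<theta>) = sin ((real s + 1) * \<theta>) + 2 * C * sin \<theta>"
      using sin_add[of "(real s + 2) * \<theta>" \<theta>] sin_diff[of "(real s + 2) * \<theta>" \<theta>]
      by (simp add: C_def algebra_simps)
    show ?thesis
      unfolding \<phi>_sum up using C0[folded C_def] by (simp add: field_simps)
  qed
  finally show ?thesis by (simp add: C_def)
qed

section \<open>The polynomials as multiple-angle functions\<close>

text \<open>
  The upper limit \<open>n\<close> is larger than necessary; the additional binomial coefficients vanish, and
  the limit no longer depends on the parity of \<open>n\<close>.
\<close>

lemma poly_P_hat: "poly (P_hat n) y = (\<Sum>k\<le>n. real (n choose (2 * k + 1)) * (- y) ^ k)"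
proof -
  have "poly (P_hat n) y = (\<Sum>k=0..(n - 1) div 2. real (n choose (2 * k + 1)) * (- y) ^ k)"
    by (simp add: P_hat_def P_poly_def poly_pcompose poly_sum poly_monom)
  also have "\<dots> = (\<Sum>k\<le>n. real (n choose (2 * k + 1)) * (- y) ^ k)"
  proof (rule sum.mono_neutral_left)
    have "n choose (2 * k + 1) = 0" if "k \<notin> {0..(n - 1) div 2}" for k
      using that by (intro binomial_eq_0) auto
    then show "\<forall>k\<in>{..n} - {0..(n - 1) div 2}. real (n choose (2 * k + 1)) * (- y) ^ k = 0"
      by simp
  qed auto
  finally show ?thesis .
qed

text \<open>
  The real and imaginary parts of \<open>(1 + \<i> tan \<theta>)\<^sup>n = exp (\<i> n \<theta>) / (cos \<theta>)\<^sup>n\<close>, by induction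
  through Pascal's rule. The common bound \<open>N\<close> lets the same index range serve for all \<open>n\<close> in
  the induction.
\<close>

lemma multiple_angle_sums:
  fixes \<theta> :: real
  assumes c0: "cos \<theta> \<noteq> 0" and "n \<le> N"
  shows "cos (real n * \<theta>) = cos \<theta> ^ n * (\<Sum>k\<le>N. real (n choose (2 * k)) * (- (tan \<theta>)\<^sup>2) ^ k)
    \<and> sin (real n * \<theta>)
      = cos \<theta> ^ n * tan \<theta> * (\<Sum>k\<le>N. real (n choose (2 * k + 1)) * (- (tan \<theta>)\<^sup>2) ^ k)"
  using \<open>n \<le> N\<close>
proof (induction n)
  case 0
  have "(\<Sum>k\<le>N. real (0 choose (2 * k)) * (- (tan \<theta>)\<^sup>2) ^ k) = (\<Sum>k\<le>N. if k = 0 then 1 else 0)"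
    by (intro sum.cong) auto
  then show ?case by simp
next
  case (Suc n)
  let ?y = "- (tan \<theta>)\<^sup>2"
  let ?E = "\<lambda>n. \<Sum>k\<le>N. real (n choose (2 * k)) * ?y ^ k"
  let ?O = "\<lambda>n. \<Sum>k\<le>N. real (n choose (2 * k + 1)) * ?y ^ k"
  have O: "?O (Suc n) = ?O n + ?E n"
    by (simp add: sum.distrib[symmetric] algebra_simps)
  have "?E (Suc n) = ?E n + (\<Sum>k\<le>N. (if k = 0 then 0 else real (n choose (2 * k - 1)) * ?y ^ k))"
    unfolding sum.distrib[symmetric]
  proof (intro sum.cong refl)
    fix k show "real (Suc n choose (2 * k)) * ?y ^ k = real (n choose (2 * k)) * ?y ^ k
        + (if k = 0 then 0 else real (n choose (2 * k - 1)) * ?y ^ k)"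
      by (cases k) (simp_all add: algebra_simps)
  qed
  also have "(\<Sum>k\<le>N. (if k = 0 then 0 else real (n choose (2 * k - 1)) * ?y ^ k))
      = (\<Sum>k<N. real (n choose (2 * k + 1)) * ?y ^ Suc k)"
    by (simp add: sum.atMost_shift)
  also have "\<dots> = ?y * ?O n"
  proof -
    have "?O n = (\<Sum>k<N. real (n choose (2 * k + 1)) * ?y ^ k)"
      using Suc.prems by (simp add: lessThan_Suc_atMost[symmetric])
    then show ?thesis by (simp add: sum_distrib_left mult_ac)
  qed
  finally have E: "?E (Suc n) = ?E n - (tan \<theta>)\<^sup>2 * ?O n" by simp
  have IH: "cos (real n * \<theta>) = cos \<theta> ^ n * ?E n" "sin (real n * \<theta>) = cos \<theta> ^ n * tan \<theta> * ?O n"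
    using Suc by simp_all
  have t: "sin \<theta> = cos \<theta> * tan \<theta>" using c0 by (simp add: tan_def)
  have angle: "real (Suc n) * \<theta> = real n * \<theta> + \<theta>" by (simp add: algebra_simps)
  show ?case
    unfolding angle cos_add sin_add IH E O unfolding t
    by (simp add: power2_eq_square algebra_simps)
qed

lemma poly_P_hat_tan:
  fixes \<theta> :: real
  assumes "cos \<theta> \<noteq> 0" "tan \<theta> \<noteq> 0"
  shows "poly (P_hat n) ((tan \<theta>)\<^sup>2) = sin (real n * \<theta>) / (cos \<theta> ^ n * tan \<theta>)"
  using multiple_angle_sums[OF assms(1) order_refl, of n] assms by (simp add: poly_P_hat)

text \<open>
  The isolated powers of \<open>W\<close> in the definition of \<open>R_poly\<close> fill up a geometric sum: the weighted
  ones are the upper half in reverse order.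
\<close>

lemma reflected_powers:
  fixes V :: real
  assumes "2 * m < n"
  shows "(\<Sum>r=1..m. V ^ (n - 2 * r) * V ^ r) = (\<Sum>r\<in>{n - m..<n}. V ^ r)"
proof -
  have "(\<Sum>r=1..m. V ^ (n - 2 * r) * V ^ r) = (\<Sum>r=1..m. V ^ (n - r))"
    using assms by (intro sum.cong) (auto simp flip: power_add)
  also have "\<dots> = (\<Sum>r\<in>{n - m..<n}. V ^ r)"
    by (rule sum.reindex_bij_witness[where i="\<lambda>r. n - r" and j="\<lambda>r. n - r"]) (use assms in auto)
  finally show ?thesis .
qed

text \<open>
  In the application \<open>p n\<close> is \<open>P_hat n\<close> and \<open>q n = cos (n \<theta>) / (cos \<theta>)\<^sup>n\<close>, both regarded at
  \<open>y = tan\<^sup>2 \<theta>\<close>, and \<open>V = 1 + y\<close>. Each of the two recurrences pairs neighbouring terms of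
  \<open>R_poly\<close>. The first one pairs \<open>p (2 r)\<close> with \<open>p (2 r + 1)\<close>, which have the weight 1 in common;
  the second one pairs \<open>p (2 k + 2)\<close> with \<open>V p (2 k + 1)\<close>, which matches their weights.
\<close>

context
  fixes p q :: "nat \<Rightarrow> real" and V :: real
  assumes q: "\<And>n. q n = p (Suc n) - p n" and q_Suc: "\<And>n. q (Suc n) = p (Suc n) - V * p n"
    and p1: "p 1 = 1"
begin

lemma plain_sum: "(\<Sum>k<m. q (2 * k + 2)) = (\<Sum>r=1..m. p (2 * r + 1)) - (\<Sum>r=1..m. p (2 * r))"
  by (induction m) (simp_all add: q)

lemma weighted_sum:
  assumes "2 * m \<le> n"
  shows "(\<Sum>k\<le>m. V ^ (n - 2 * k) * q (2 * k + 2))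
    = (\<Sum>r=1..m + 1. V ^ (n + 2 - 2 * r) * p (2 * r)) - V ^ (n + 1)
      - (\<Sum>r=1..m. V ^ (n + 1 - 2 * r) * p (2 * r + 1))"
  using assms
proof (induction m)
  case 0
  have "p (Suc (Suc 0)) = q (Suc (Suc 0)) + V" using q_Suc[of 1] p1 by simp
  then show ?case by (simp add: algebra_simps)
next
  case (Suc m)
  have "n + 1 - 2 * Suc m = Suc (n - 2 * Suc m)" using Suc.prems by simp
  moreover have "q (2 * Suc m + 2) = p (2 * Suc m + 2) - V * p (2 * Suc m + 1)"
    using q_Suc[of "2 * Suc m + 1"] by simp
  ultimately have "V ^ (n - 2 * Suc m) * q (2 * Suc m + 2)
      = V ^ (n - 2 * Suc m) * p (2 * Suc m + 2) - V ^ (n + 1 - 2 * Suc m) * p (2 * Suc m + 1)"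
    by (simp only: power_Suc) (simp add: algebra_simps)
  then show ?case
    using Suc by simp
qed

end

text \<open>
  Both parities of \<open>s\<close> lead to one formula, although \<open>R_even\<close> and \<open>R_odd\<close> end differently: for
  even \<open>s\<close> the last term belongs to the second pairing only, for odd \<open>s\<close> to the first only.
\<close>

lemma poly_R_poly:
  fixes y V :: real and q :: "nat \<Rightarrow> real"
  defines "p \<equiv> \<lambda>n. poly (P_hat n) y" and "V \<equiv> 1 + y"
  assumes q: "\<And>n. q n = p (Suc n) - p n" and q_Suc: "\<And>n. q (Suc n) = p (Suc n) - V * p n"
    and p1: "p 1 = 1"
  shows "2 * poly (R_poly s) y = (\<Sum>r=1..s + 1. V ^ r)
    + (\<Sum>k | 2 * k \<le> s. V ^ (s - 2 * k) * q (2 * k + 2)) - (\<Sum>k | 2 * k < s. q (2 * k + 2))"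
proof -
  have W: "poly W y = V" by (simp add: W_def V_def)
  note plain = plain_sum[of q p V, OF q q_Suc p1]
  note weighted = weighted_sum[of q p V, OF q q_Suc p1]
  show ?thesis
  proof (cases "even s")
    case True
    then obtain l where s: "s = 2 * l" by auto
    have sets: "{k. 2 * k \<le> s} = {..l}" "{k. 2 * k < s} = {..<l}" by (auto simp: s)
    have geo: "(\<Sum>r=1..s + 1. V ^ r)
        = (\<Sum>r=1..l. V ^ r) + (\<Sum>r=1..l. V ^ (2 * l + 1 - 2 * r) * V ^ r) + V ^ (2 * l + 1)"
    proof -
      have "{1..s + 1} = insert (2 * l + 1) ({1..l} \<union> {2 * l + 1 - l..<2 * l + 1})"
        by (auto simp: s)
      then have "(\<Sum>r=1..s + 1. V ^ r)
          = V ^ (2 * l + 1) + (\<Sum>r\<in>{1..l} \<union> {2 * l + 1 - l..<2 * l + 1}. V ^ r)"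
        by simp
      also have "(\<Sum>r\<in>{1..l} \<union> {2 * l + 1 - l..<2 * l + 1}. V ^ r)
          = (\<Sum>r=1..l. V ^ r) + (\<Sum>r\<in>{2 * l + 1 - l..<2 * l + 1}. V ^ r)"
        by (rule sum.union_disjoint) auto
      finally show ?thesis using reflected_powers[of l "2 * l + 1" V] by linarith
    qed
    have "2 * poly (R_poly s) y = (\<Sum>r=1..l. (1 + V ^ (2 * l + 2 - 2 * r)) * p (2 * r)) + p (2 * l + 2)
        - (\<Sum>r=1..l. (1 + V ^ (2 * l + 1 - 2 * r)) * (p (2 * r + 1) - V ^ r))"
      by (simp add: R_poly_def s R_even_def poly_sum W p_def)
    then show ?thesis
      unfolding geo sets plain using weighted[of l s]
      by (simp add: s algebra_simps sum.distrib sum_subtractf)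
  next
    case False
    then obtain l where s: "s = 2 * l + 1" by (auto elim: oddE)
    have sets: "{k. 2 * k \<le> s} = {..l}" "{k. 2 * k < s} = {..<l + 1}" by (auto simp: s)
    have geo: "(\<Sum>r=1..s + 1. V ^ r)
        = (\<Sum>r=1..l. V ^ r) + V ^ (l + 1) + (\<Sum>r=1..l. V ^ (2 * l + 2 - 2 * r) * V ^ r) + V ^ (2 * l + 2)"
    proof -
      have "{1..s + 1} = insert (2 * l + 2) (insert (l + 1) ({1..l} \<union> {2 * l + 2 - l..<2 * l + 2}))"
        by (auto simp: s)
      then have "(\<Sum>r=1..s + 1. V ^ r)
          = V ^ (2 * l + 2) + (V ^ (l + 1) + (\<Sum>r\<in>{1..l} \<union> {2 * l + 2 - l..<2 * l + 2}. V ^ r))"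
        by simp
      also have "(\<Sum>r\<in>{1..l} \<union> {2 * l + 2 - l..<2 * l + 2}. V ^ r)
          = (\<Sum>r=1..l. V ^ r) + (\<Sum>r\<in>{2 * l + 2 - l..<2 * l + 2}. V ^ r)"
        by (rule sum.union_disjoint) auto
      finally show ?thesis using reflected_powers[of l "2 * l + 2" V] by linarith
    qed
    have "2 * poly (R_poly s) y = (\<Sum>r=1..l + 1. (1 + V ^ (2 * l + 3 - 2 * r)) * p (2 * r))
        - (\<Sum>r=1..l. (1 + V ^ (2 * l + 2 - 2 * r)) * (p (2 * r + 1) - V ^ r)) - (p (2 * l + 3) - V ^ (l + 1))"
      by (simp add: R_poly_def s R_odd_def poly_sum W p_def algebra_simps)
    then show ?thesis
      unfolding geo sets plain using weighted[of l s]
      by (simp add: s algebra_simps sum.distrib sum_subtractf eval_nat_numeral)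
  qed
qed

section \<open>The odd trace\<close>

text \<open>
  Twice \<open>cos ((s + 2) \<theta>)\<close> times a diagonal entry of \<open>H\<close> is a linear combination of powers of
  \<open>cos \<theta>\<close>: the square of the cosine contributes \<open>1 + cos ((2 k + 2) \<theta>)\<close>, and the product of
  two cosines for \<open>2 k > s\<close> contributes the same cosine, which cancels, and its reflection under
  \<open>k \<mapsto> s - k\<close>. The three resulting sums are those of \<open>poly_R_poly\<close>.
\<close>

lemma trace_odd:
  fixes \<theta> :: real
  assumes c0: "cos \<theta> \<noteq> 0" and t0: "tan \<theta> \<noteq> 0" and C0: "cos ((real s + 2) * \<theta>) \<noteq> 0"
    and small: "(tan \<theta>)\<^sup>2 * (real s + 1)\<^sup>2 < 1"
  shows "cos ((real s + 2) * \<theta>) * (\<Sum>k\<le>s. gen_odd s ((tan \<theta>)\<^sup>2) k k)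
    = cos \<theta> ^ (s + 2) * poly (R_poly s) ((tan \<theta>)\<^sup>2)"
proof -
  define c C where "c = cos \<theta>" and "C = cos ((real s + 2) * \<theta>)"
  have c: "c \<noteq> 0" using c0 by (simp add: c_def)
  define q where "q n = cos (real n * \<theta>) / c ^ n" for n
  define p where "p n = poly (P_hat n) ((tan \<theta>)\<^sup>2)" for n
  define V where "V = 1 + (tan \<theta>)\<^sup>2"
  have V: "V = 1 / c\<^sup>2"
    using tan_sec[OF c0] by (simp add: V_def c_def inverse_eq_divide power_divide)
  have p: "p n = sin (real n * \<theta>) / (c ^ n * tan \<theta>)" for n
    unfolding p_def c_def by (rule poly_P_hat_tan[OF c0 t0])
  have angle: "real (Suc n) * \<theta> = real n * \<theta> + \<theta>" for n by (simp add: algebra_simps)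
  have sin_c: "sin \<theta> = c * tan \<theta>" using c0 by (simp add: tan_def c_def)
  have q_eq: "q n = p (Suc n) - p n" for n
    unfolding p q_def angle sin_add sin_c c_def[symmetric] using c t0 by (simp add: field_simps)
  have q_Suc: "q (Suc n) = p (Suc n) - V * p n" for n
    unfolding p q_def angle sin_add cos_add sin_c c_def[symmetric] V_def
    using c t0 by (simp add: field_simps power2_eq_square)
  have "p 1 = 1" using c t0 by (simp add: p sin_c)
  note R = poly_R_poly[of q "(tan \<theta>)\<^sup>2", folded p_def V_def, OF q_eq q_Suc this, of s]
  define g where "g k = c ^ (2 * k) / c ^ s" for k
  define co where "co k = cos (real (2 * k + 2) * \<theta>)" for k
  have diag: "2 * C * gen_odd s ((tan \<theta>)\<^sup>2) k k
      = g k + of_bool (2 * k \<le> s) * (g k * co k) - of_bool (s < 2 * k) * (g k * co (s - k))"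
    if "k \<le> s" for k
  proof -
    have 1: "2 * (cos ((real k + 1) * \<theta>))\<^sup>2 = 1 + co k"
      using cos_double_cos[of "(real k + 1) * \<theta>"] by (simp add: co_def algebra_simps)
    have 2: "2 * C * cos ((2 * real k - real s) * \<theta>) = co (s - k) + co k"
      unfolding C_def co_def mult.assoc cos_times_cos using that
      by (simp add: of_nat_diff algebra_simps)
    have "2 * C * gen_odd s ((tan \<theta>)\<^sup>2) k k = g k * (2 * (cos ((real k + 1) * \<theta>))\<^sup>2
        - of_bool (s < 2 * k) * (2 * C * cos ((2 * real k - real s) * \<theta>)))"
      unfolding gen_odd_diag[OF c0 C0 small that] C_def[symmetric] c_def[symmetric] g_def
      using C0[folded C_def] c by (simp add: field_simps)
    then show ?thesis unfolding 1 2 by (cases "2 * k \<le> s") (simp_all add: algebra_simps)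
  qed
  have V_pow: "V ^ n = 1 / c ^ (2 * n)" for n
    by (simp add: V power_divide power_mult)
  have geo: "(\<Sum>k\<le>s. g k) = c ^ (s + 2) * (\<Sum>r=1..s + 1. V ^ r)"
  proof -
    have "(\<Sum>k\<le>s. g k) = (\<Sum>r=1..s + 1. c ^ (s + 2) * V ^ r)"
    proof (rule sum.reindex_bij_witness[where i="\<lambda>r. s + 1 - r" and j="\<lambda>k. s + 1 - k"])
      fix k assume "k \<in> {..s}"
      then have "2 * (s + 1 - k) + 2 * k = s + (s + 2)" by auto
      then have "c ^ (2 * (s + 1 - k)) * c ^ (2 * k) = c ^ s * c ^ (s + 2)"
        by (simp only: power_add[symmetric])
      then show "c ^ (s + 2) * V ^ (s + 1 - k) = g k"
        using c by (simp add: V_pow g_def field_simps del: power_Suc)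
    qed auto
    then show ?thesis by (simp only: sum_distrib_left)
  qed
  have low: "(\<Sum>k\<le>s. of_bool (2 * k \<le> s) * (g k * co k))
      = c ^ (s + 2) * (\<Sum>k | 2 * k \<le> s. V ^ (s - 2 * k) * q (2 * k + 2))"
  proof -
    have "(\<Sum>k\<le>s. of_bool (2 * k \<le> s) * (g k * co k))
        = (\<Sum>k | 2 * k \<le> s. c ^ (s + 2) * (V ^ (s - 2 * k) * q (2 * k + 2)))"
    proof (rule sum.mono_neutral_cong_right)
      fix k assume "k \<in> {k. 2 * k \<le> s}"
      then have "s + s = 2 * (s - 2 * k) + 2 * k + 2 * k" by auto
      then have "c ^ s * c ^ s = c ^ (2 * (s - 2 * k)) * c ^ (2 * k) * c ^ (2 * k)"
        by (simp only: power_add[symmetric])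
      then show "of_bool (2 * k \<le> s) * (g k * co k) = c ^ (s + 2) * (V ^ (s - 2 * k) * q (2 * k + 2))"
        using c \<open>k \<in> _\<close> by (simp add: V_pow g_def q_def co_def field_simps power_add)
    qed auto
    then show ?thesis by (simp only: sum_distrib_left)
  qed
  have high: "(\<Sum>k\<le>s. of_bool (s < 2 * k) * (g k * co (s - k)))
      = c ^ (s + 2) * (\<Sum>k | 2 * k < s. q (2 * k + 2))"
  proof -
    have "(\<Sum>k\<le>s. of_bool (s < 2 * k) * (g k * co (s - k)))
        = (\<Sum>k | k \<le> s \<and> s < 2 * k. g k * co (s - k))"
      by (rule sum.mono_neutral_cong_right) auto
    also have "\<dots> = (\<Sum>k | 2 * k < s. c ^ (s + 2) * q (2 * k + 2))"
    proof (rule sum.reindex_bij_witness[where i="\<lambda>k. s - k" and j="\<lambda>k. s - k"])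
      fix k assume "k \<in> {k. k \<le> s \<and> s < 2 * k}"
      then have "s + s = 2 * k + 2 * (s - k)" by auto
      then have "c ^ s * c ^ s = c ^ (2 * k) * c ^ (2 * (s - k))"
        by (simp only: power_add[symmetric])
      then show "c ^ (s + 2) * q (2 * (s - k) + 2) = g k * co (s - k)"
        using c by (simp add: g_def q_def co_def field_simps power_add)
    qed auto
    finally show ?thesis by (simp only: sum_distrib_left)
  qed
  have "2 * (C * (\<Sum>k\<le>s. gen_odd s ((tan \<theta>)\<^sup>2) k k))
      = (\<Sum>k\<le>s. g k + of_bool (2 * k \<le> s) * (g k * co k) - of_bool (s < 2 * k) * (g k * co (s - k)))"
    by (simp add: sum_distrib_left diag mult.assoc[symmetric] del: sum_of_bool_mult_eq)
  also have "\<dots> = c ^ (s + 2) * (2 * poly (R_poly s) ((tan \<theta>)\<^sup>2))"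
    unfolding sum_subtractf sum.distrib geo low high R by (simp only: ring_distribs)
  finally show ?thesis by (simp add: C_def c_def)
qed

section \<open>Evaluation of the two power series\<close>

text \<open>
  A count in dimension \<open>d \<ge> 2\<close> is the trace of the walk matrix of length \<open>d\<close>. The series of
  counts therefore lack only the first terms of the matrix series \<open>G\<close> and \<open>H\<close>, whose traces are
  \<open>s + 1\<close> and the number \<open>\<tau>\<^sub>s\<close> of indices \<open>a\<close> with \<open>2 a \<le> s\<close>.
\<close>

lemma eval_Psi_cyc:
  fixes y :: real
  assumes "0 \<le> y" "y * (real s + 1)\<^sup>2 < 1"
  shows "y * eval_fps (Psi_cyc s) y = (\<Sum>a\<le>s. gen_even s y a a - 1)"
proof -
  have sm: "summable (\<lambda>n. real (walks s (2 * Suc n) a a) * y ^ n)" for a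
    using summable_walks[OF assms, of 2 a a] by (simp del: walks.simps add: numeral_2_eq_2)
  have "eval_fps (Psi_cyc s) y = (\<Sum>n. \<Sum>a\<le>s. real (walks s (2 * Suc n) a a) * y ^ n)"
    unfolding eval_fps_def Psi_cyc_def
    by (simp add: N_cyc_eq_trace sum_distrib_right del: walks.simps)
  also have "\<dots> = (\<Sum>a\<le>s. \<Sum>n. real (walks s (2 * Suc n) a a) * y ^ n)"
    by (rule suminf_sum) (rule sm)
  finally have "y * eval_fps (Psi_cyc s) y = (\<Sum>a\<le>s. y * (\<Sum>n. real (walks s (2 * Suc n) a a) * y ^ n))"
    by (simp only: sum_distrib_left)
  also have "\<dots> = (\<Sum>a\<le>s. gen_even s y a a - 1)"
  proof (rule sum.cong[OF refl])
    fix a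
    have "y * (\<Sum>n. real (walks s (2 * Suc n) a a) * y ^ n)
        = (\<Sum>n. real (walks s (2 * Suc n) a a) * y ^ Suc n)"
      by (subst suminf_mult[OF sm, symmetric]) (simp add: mult_ac del: walks.simps)
    also have "\<dots> = gen_even s y a a - 1"
      unfolding gen_even_def
      using suminf_split_head[OF summable_walks[OF assms, of 0 a a]] by (simp del: walks.simps(2))
    finally show "y * (\<Sum>n. real (walks s (2 * Suc n) a a) * y ^ n) = gen_even s y a a - 1" .
  qed
  finally show ?thesis .
qed

lemma eval_Omega_cyc:
  fixes y :: real
  assumes "0 \<le> y" "y * (real s + 1)\<^sup>2 < 1"
  shows "y * eval_fps (Omega_cyc s) y = (\<Sum>a\<le>s. gen_odd s y a a) - real (tau s)"
proof -
  have sm: "summable (\<lambda>n. real (walks s (2 * Suc n + 1) a a) * y ^ n)" for a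
    using summable_walks[OF assms, of 3 a a] by (simp del: walks.simps add: numeral_3_eq_3)
  have "eval_fps (Omega_cyc s) y = (\<Sum>n. \<Sum>a\<le>s. real (walks s (2 * Suc n + 1) a a) * y ^ n)"
    unfolding eval_fps_def Omega_cyc_def
    by (simp add: N_cyc_eq_trace sum_distrib_right del: walks.simps)
  also have "\<dots> = (\<Sum>a\<le>s. \<Sum>n. real (walks s (2 * Suc n + 1) a a) * y ^ n)"
    by (rule suminf_sum) (rule sm)
  finally have "y * eval_fps (Omega_cyc s) y
      = (\<Sum>a\<le>s. y * (\<Sum>n. real (walks s (2 * Suc n + 1) a a) * y ^ n))"
    by (simp only: sum_distrib_left)
  also have "\<dots> = (\<Sum>a\<le>s. gen_odd s y a a - real (walks s 1 a a))"
  proof (rule sum.cong[OF refl])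
    fix a
    have "y * (\<Sum>n. real (walks s (2 * Suc n + 1) a a) * y ^ n)
        = (\<Sum>n. real (walks s (2 * Suc n + 1) a a) * y ^ Suc n)"
      by (subst suminf_mult[OF sm, symmetric]) (simp add: mult_ac del: walks.simps)
    also have "\<dots> = gen_odd s y a a - real (walks s 1 a a)"
      unfolding gen_odd_def
      using suminf_split_head[OF summable_walks[OF assms, of 1 a a]] by (simp del: walks.simps)
    finally show "y * (\<Sum>n. real (walks s (2 * Suc n + 1) a a) * y ^ n)
      = gen_odd s y a a - real (walks s 1 a a)" .
  qed
  also have "\<dots> = (\<Sum>a\<le>s. gen_odd s y a a) - real (\<Sum>a\<le>s. walks s 1 a a)"
    by (simp add: sum_subtractf del: walks.simps)
  also have "(\<Sum>a\<le>s. walks s 1 a a) = (\<Sum>a\<le>s. of_bool (2 * a \<le> s))"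
  proof (rule sum.cong[OF refl])
    fix a assume "a \<in> {..s}"
    then have "(\<Sum>c\<le>s. of_bool (a = c) * edge s 1 c a) = (\<Sum>c\<le>s. if a = c then edge s 1 c a else 0)"
      by (intro sum.cong) auto
    then show "walks s 1 a a = of_bool (2 * a \<le> s)"
      using \<open>a \<in> _\<close> by (simp add: edge_def mult_2 del: sum_of_bool_mult_eq)
  qed
  also have "\<dots> = card {a. a \<le> s \<and> 2 * a \<le> s}"
    by simp (rule arg_cong[where f=card], auto)
  also have "{a. a \<le> s \<and> 2 * a \<le> s} = {..s div 2}" by auto
  finally show ?thesis by (simp add: tau_def)
qed

lemma conv_radius_pos:
  fixes f :: "nat \<Rightarrow> real"
  assumes "y > 0" "summable (\<lambda>n. f n * y ^ n)"
  shows "conv_radius f > 0"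
  using conv_radius_geI[OF assms(2)] assms(1)
  by (metis ereal_less(2) less_le_trans norm_of_real real_norm_def zero_less_norm_iff less_irrefl)

lemma conv_radius_N_cyc:
  assumes "r \<ge> 2"
  shows "conv_radius (\<lambda>n. real (N_cyc (2 * n + r) s)) > 0"
proof (rule conv_radius_pos)
  let ?y = "1 / (2 * (real s + 1)\<^sup>2)"
  show "?y > 0" by simp
  have "?y * (real s + 1)\<^sup>2 = 1 / 2" by (simp add: field_simps)
  then have "summable (\<lambda>n. \<Sum>a\<le>s. real (walks s (2 * n + r) a a) * ?y ^ n)"
    by (intro summable_sum summable_walks) simp_all
  then show "summable (\<lambda>n. real (N_cyc (2 * n + r) s) * ?y ^ n)"
    using assms by (simp add: N_cyc_eq_trace sum_distrib_right)
qed

theorem theorem1p6: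
  fixes s :: nat
  assumes "s \<ge> 1"
  shows "fps_conv_radius (Psi_cyc s) > 0 \<and> fps_conv_radius (Omega_cyc s) > 0 \<and>
    (\<exists>\<epsilon>>0. \<forall>y::real. 0 < y \<and> y < \<epsilon> \<longrightarrow>
      (let \<theta> = arctan (sqrt y) in
         eval_fps (Psi_cyc s) y =
           (real s + 2) / 2 *
             (sin ((real s + 1) * \<theta>) * (cos \<theta>)\<^sup>2 / (sin \<theta> * cos ((real s + 2) * \<theta>)))
       \<and> eval_fps (Omega_cyc s) ((tan \<theta>)\<^sup>2) =
           (cos \<theta> ^ (s + 2) * poly (R_poly s) ((tan \<theta>)\<^sup>2)
              - real (tau s) * cos ((real s + 2) * \<theta>))
           / ((tan \<theta>)\<^sup>2 * cos ((real s + 2) * \<theta>))))"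
proof (intro conjI exI allI impI)
  show "fps_conv_radius (Psi_cyc s) > 0"
    using conv_radius_N_cyc[of 2 s] by (simp add: fps_conv_radius_def Psi_cyc_def)
  show "fps_conv_radius (Omega_cyc s) > 0"
    using conv_radius_N_cyc[of 3 s] by (simp add: fps_conv_radius_def Omega_cyc_def numeral_3_eq_3)
  \<comment> \<open>For \<open>y\<close> below this bound, \<open>(s + 2) \<theta> \<le> (s + 2) \<surd>y < 1 < \<pi> / 2\<close>, so the denominator
    \<open>cos ((s + 2) \<theta>)\<close> is positive, and the matrix series converge.\<close>
  show "0 < 1 / (real s + 2)\<^sup>2" by simp
next
  fix y :: real
  assume y: "0 < y \<and> y < 1 / (real s + 2)\<^sup>2"
  define \<theta> where "\<theta> = arctan (sqrt y)"
  define C where "C = cos ((real s + 2) * \<theta>)"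
  have tan: "tan \<theta> = sqrt y" by (simp add: \<theta>_def tan_arctan)
  have y_tan: "(tan \<theta>)\<^sup>2 = y" using y by (simp add: tan)
  have t0: "tan \<theta> \<noteq> 0" using y by (simp add: tan)
  have c0: "cos \<theta> \<noteq> 0" by (simp add: \<theta>_def)
  have sin0: "sin \<theta> \<noteq> 0" using t0 by (auto simp: tan_def)
  have "\<theta> \<ge> 0" using y by (simp add: \<theta>_def)
  have "\<theta> \<le> sqrt y"
    unfolding \<theta>_def using y by (intro arctan_le_self) simp
  also have "sqrt y < 1 / (real s + 2)"
    using y by (intro real_less_lsqrt) (auto simp: power_divide)
  finally have "(real s + 2) * \<theta> < 1" by (simp add: field_simps)
  then have C0: "C \<noteq> 0"
    unfolding C_def using \<open>\<theta> \<ge> 0\<close> pi_gt3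
    by (intro less_imp_neq[symmetric] cos_gt_zero_pi) (auto intro: less_le_trans[of _ 0])
  have small: "y * (real s + 1)\<^sup>2 < 1"
  proof -
    have "y * (real s + 1)\<^sup>2 \<le> y * (real s + 2)\<^sup>2"
      using y by (intro mult_left_mono power_mono) auto
    also have "\<dots> < 1" using y by (simp add: field_simps)
    finally show ?thesis .
  qed
  have small': "(tan \<theta>)\<^sup>2 * (real s + 1)\<^sup>2 < 1" using small by (simp add: y_tan)
  define E where "E = eval_fps (Psi_cyc s) y"
  have "E = y * E / y" using y by simp
  also have "y * E = (real s + 2) / 2 * (sin \<theta> * sin ((real s + 1) * \<theta>) / C)"
    using eval_Psi_cyc[of y s] trace_even[OF c0 _ small'] y small C0 by (simp add: y_tan C_def E_def)
  also have "y = (sin \<theta>)\<^sup>2 / (cos \<theta>)\<^sup>2" by (simp add: y_tan[symmetric] tan_def power_divide)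
  also have "(real s + 2) / 2 * (sin \<theta> * sin ((real s + 1) * \<theta>) / C) / ((sin \<theta>)\<^sup>2 / (cos \<theta>)\<^sup>2)
      = (real s + 2) / 2 * (sin ((real s + 1) * \<theta>) * (cos \<theta>)\<^sup>2 / (sin \<theta> * C))"
    using sin0 c0 C0 by (simp add: power2_eq_square)
  finally have psi: "E = (real s + 2) / 2 * (sin ((real s + 1) * \<theta>) * (cos \<theta>)\<^sup>2 / (sin \<theta> * C))" .
  have "C * (y * eval_fps (Omega_cyc s) y)
      = cos \<theta> ^ (s + 2) * poly (R_poly s) y - real (tau s) * C"
  proof -
    have "y * eval_fps (Omega_cyc s) y = (\<Sum>k\<le>s. gen_odd s y k k) - real (tau s)"
      using eval_Omega_cyc[of y s] y small by simp
    moreover have "C * (\<Sum>k\<le>s. gen_odd s y k k) = cos \<theta> ^ (s + 2) * poly (R_poly s) y"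
      using trace_odd[OF c0 t0 _ small'] C0 by (simp add: y_tan C_def)
    ultimately show ?thesis by (simp add: right_diff_distrib mult.commute)
  qed
  then have omega: "eval_fps (Omega_cyc s) y
      = (cos \<theta> ^ (s + 2) * poly (R_poly s) y - real (tau s) * C) / (y * C)"
    using y C0 by (simp add: field_simps)
  show "let \<theta> = arctan (sqrt y) in
         eval_fps (Psi_cyc s) y =
           (real s + 2) / 2 *
             (sin ((real s + 1) * \<theta>) * (cos \<theta>)\<^sup>2 / (sin \<theta> * cos ((real s + 2) * \<theta>)))
       \<and> eval_fps (Omega_cyc s) ((tan \<theta>)\<^sup>2) =
           (cos \<theta> ^ (s + 2) * poly (R_poly s) ((tan \<theta>)\<^sup>2)
              - real (tau s) * cos ((real s + 2) * \<theta>))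
           / ((tan \<theta>)\<^sup>2 * cos ((real s + 2) * \<theta>))"
    using psi omega unfolding Let_def \<theta>_def[symmetric] y_tan C_def E_def by blast
qed

end
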